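(* For any $n\geq 1$, $w\in\{+,-\}^n$ and nonnegative integers $i,j,k$ with $i+j+k=n$, we have \begin{align*} f^+_{w+,i,j,k}&=\sum_{j'=0}^{j-1} f^-_{w,i+j-1-j',j',k}+\sum_{k'=0}^{k-1} f^+_{w,k-1-k',i+j,k'},\\ f^-_{w+,i,j,k}&=\sum_{i'=0}^{i-1} f^+_{w,i',j,i+k-1-i'},\\ f^+_{w-,i,j,k}&=\sum_{i'=0}^{i-1} f^-_{w,i',i+j-1-i',k},\\ f^-_{w-,i,j,k}&=\sum_{k'=0}^{k-1} f^+_{w,i+k-1-k',j,k'}+\sum_{j'=0}^{j-1} f^-_{w,j-1-j',j',i+k}, \end{align*} where empty sums are $0$.
   Context: A total cyclic order on a finite set $X$ is a set $Z$ of triples of distinct elements of $X$ such that: $(x,y,z)\in Z\Rightarrow (y,z,x)\in Z$; $(x,y,z)\in Z\Rightarrow (z,y,x)\notin Z$; $(x,y,z)\in Z$ and $(x,z,u)\in Z\Rightarrow (x,y,u)\in Z$; and for any three distinct $x,y,z$, either $(x,y,z)\in Z$ or $(z,y,x)\in Z$. For $w=\epsilon_1\cdots\epsilon_{m-2}\in\{+,-\}^{m-2}$ ($m\geq3$), $\mathcal{P}_w$ is the set of total cyclic orders $Z$ on $[m]$ such that for every $1\leq i\leq m-2$, $(i,i+1,i+2)\in Z$ if $\epsilon_i=+$ and $(i+2,i+1,i)\in Z$ if $\epsilon_i=-$. $\mathcal{Q}^+_w$ (resp. $\mathcal{Q}^-_w$) is the set of $Z\in\mathcal{P}_w$ with $(m-1,m,1)\in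 Z$ (resp. $(1,m,m-1)\in Z$). The content of the arc from $a$ to $b$ is $c_Z(a,b)=\#\{x:(a,x,b)\in Z\}$, and the multi-content of distinct $y_1,\dots,y_p$ is $\tilde c_Z(y_1,\dots,y_p)=(c_Z(y_1,y_2),\dots,c_Z(y_{p-1},y_p),c_Z(y_p,y_1))$. For $w\in\{+,-\}^{m-2}$ and nonnegative $i,j,k$ with $i+j+k=m-3$, set $f^+_{w,i,j,k}=\#\{Z\in\mathcal{Q}^+_w:\tilde c_Z(m-1,m,1)=(i,j,k)\}$ and $f^-_{w,i,j,k}=\#\{Z\in\mathcal{Q}^-_w:\tilde c_Z(m,m-1,1)=(i,j,k)\}$. For a word $w$, $w+$ (resp. $w-$) denotes $w$ with the letter $+$ (resp. $-$) appended at the end. *)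

theory Defs
  imports Main
begin

definition total_cyclic_order_on :: "'a set \<Rightarrow> ('a \<times> 'a \<times> 'a) set \<Rightarrow> bool" where
  "total_cyclic_order_on X Z \<longleftrightarrow>
     finite X \<and>
     Z \<subseteq> {(x, y, z). x \<in> X \<and> y \<in> X \<and> z \<in> X \<and> x \<noteq> y \<and> y \<noteq> z \<and> x \<noteq> z} \<and>
     (\<forall>x y z. (x, y, z) \<in> Z \<longrightarrow> (y, z, x) \<in> Z) \<and>
     (\<forall>x y z. (x, y, z) \<in> Z \<longrightarrow> (z, y, x) \<notin> Z) \<and>
     (\<forall>x y z u. (x, y, z) \<in> Z \<and> (x, z, u) \<in> Z \<longrightarrow> (x, y, u) \<in> Z) \<and>
     (\<forall>x\<in>X. \<forall>y\<in>X. \<forall>z\<in>X. x \<noteq> y \<and> y \<noteq> z \<and> x \<noteq> z \<longrightarrow> (x, y, z) \<in> Z \<or> (z, y, x) \<in> Z)"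

datatype sign = Plus | Minus

text \<open>
  A word of length \<open>m - 2\<close> describes orders on \<open>{1..m}\<close>, so \<open>m\<close> is recovered as
  \<open>length w + 2\<close>.  The letters of a word are numbered from 1, whereas list indexing
  starts at 0.
\<close>

definition P_set :: "sign list \<Rightarrow> (nat \<times> nat \<times> nat) set set" where
  "P_set w = {Z. total_cyclic_order_on {1..length w + 2} Z \<and>
     (\<forall>i\<in>{1..length w}.
        (w ! (i - 1) = Plus \<longrightarrow> (i, i + 1, i + 2) \<in> Z) \<and>
        (w ! (i - 1) = Minus \<longrightarrow> (i + 2, i + 1, i) \<in> Z))}"

definition Q_plus :: "sign list \<Rightarrow> (nat \<times> nat \<times> nat) set set" where
  "Q_plus w = (let m = length w + 2 in {Z \<in> P_set w. (m - 1, m, 1) \<in> Z})"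

definition Q_minus :: "sign list \<Rightarrow> (nat \<times> nat \<times> nat) set set" where
  "Q_minus w = (let m = length w + 2 in {Z \<in> P_set w. (1, m, m - 1) \<in> Z})"

definition arc_content :: "('a \<times> 'a \<times> 'a) set \<Rightarrow> 'a \<Rightarrow> 'a \<Rightarrow> nat" where
  "arc_content Z a b = card {x. (a, x, b) \<in> Z}"

definition multi_content :: "('a \<times> 'a \<times> 'a) set \<Rightarrow> 'a list \<Rightarrow> nat list" where
  "multi_content Z ys = map2 (arc_content Z) ys (rotate1 ys)"

definition f_plus :: "sign list \<Rightarrow> nat \<Rightarrow> nat \<Rightarrow> nat \<Rightarrow> nat" where
  "f_plus w i j k = (let m = length w + 2 in
     card {Z \<in> Q_plus w. multi_content Z [m - 1, m, 1] = [i, j, k]})"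

definition f_minus :: "sign list \<Rightarrow> nat \<Rightarrow> nat \<Rightarrow> nat \<Rightarrow> nat" where
  "f_minus w i j k = (let m = length w + 2 in
     card {Z \<in> Q_minus w. multi_content Z [m, m - 1, 1] = [i, j, k]})"

end

theory Submission
  imports Defs
begin

text \<open>
  Fix the base point \<open>m\<close>.  A total cyclic order \<open>Z\<close> is determined by the contents \<open>c(m, x)\<close>,
  and an order on \<open>{1..m + 1}\<close> amounts to an order on \<open>{1..m}\<close> together with the content
  \<open>c(m, m + 1)\<close>, which may be chosen freely.  All numbers in the theorem are therefore counts of
  orders in \<open>P_w\<close> with \<open>c(m, 1) = s\<close> and \<open>c(m, m - 1)\<close> in some range, and
  the right-hand sides split these counts by the value of \<open>c(m, m - 1)\<close>.
\<close>

section \<open>Contents of arcs\<close>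

context
  fixes X :: "'a set" and Z :: "('a \<times> 'a \<times> 'a) set"
  assumes Z: "total_cyclic_order_on X Z"
begin

lemma tco_finite: "finite X"
  using Z unfolding total_cyclic_order_on_def by blast

lemma tco_mem:
  assumes "(x, y, z) \<in> Z"
  shows "x \<in> X \<and> y \<in> X \<and> z \<in> X \<and> x \<noteq> y \<and> y \<noteq> z \<and> x \<noteq> z"
proof -
  have "Z \<subseteq> {(x, y, z). x \<in> X \<and> y \<in> X \<and> z \<in> X \<and> x \<noteq> y \<and> y \<noteq> z \<and> x \<noteq> z}"
    using Z unfolding total_cyclic_order_on_def by (elim conjE)
  then show ?thesis using assms by auto
qed

lemma tco_rotate: "(x, y, z) \<in> Z \<Longrightarrow> (y, z, x) \<in> Z"
  using Z unfolding total_cyclic_order_on_def by blast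

lemma tco_rotate_iff: "(x, y, z) \<in> Z \<longleftrightarrow> (y, z, x) \<in> Z"
  using tco_rotate by blast

lemma tco_asym: "(x, y, z) \<in> Z \<Longrightarrow> (z, y, x) \<notin> Z"
  using Z unfolding total_cyclic_order_on_def by blast

lemma tco_trans: "(x, y, z) \<in> Z \<Longrightarrow> (x, z, u) \<in> Z \<Longrightarrow> (x, y, u) \<in> Z"
  using Z unfolding total_cyclic_order_on_def by blast

lemma tco_total:
  "x \<in> X \<Longrightarrow> y \<in> X \<Longrightarrow> z \<in> X \<Longrightarrow> x \<noteq> y \<Longrightarrow> y \<noteq> z \<Longrightarrow> x \<noteq> z \<Longrightarrow> (x, y, z) \<in> Z \<or> (z, y, x) \<in> Z"
  using Z unfolding total_cyclic_order_on_def by blast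

text \<open>Fixing a base point \<open>a\<close> turns the ternary relation into a strict linear
  order on the remaining elements: \<open>(a, x, y)\<close> reads as \<open>x\<close> before
  \<open>y\<close> when starting from \<open>a\<close>.\<close>

lemma tco_linear:
  assumes "a \<in> X" "x \<in> X" "y \<in> X" "a \<noteq> x" "a \<noteq> y" "x \<noteq> y"
  shows "(a, x, y) \<in> Z \<longleftrightarrow> (a, y, x) \<notin> Z"
  using tco_total[of a x y] tco_asym[of a x y] tco_rotate assms by blast

lemma tco_finite_arc: "finite {x. (a, x, b) \<in> Z}"
  by (rule finite_subset[OF _ tco_finite]) (use tco_mem in blast)

text \<open>Transitivity nests the two arcs, and \<open>x\<close> itself lies on the larger one
  only.\<close>

lemma arc_content_strict_mono:
  assumes "(a, x, y) \<in> Z"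
  shows "arc_content Z a x < arc_content Z a y"
  unfolding arc_content_def
proof (rule psubset_card_mono[OF tco_finite_arc])
  show "{u. (a, u, x) \<in> Z} \<subset> {u. (a, u, y) \<in> Z}"
    using assms tco_trans tco_mem by blast
qed

lemma arc_content_less_iff:
  assumes "a \<in> X" "x \<in> X" "y \<in> X" "a \<noteq> x" "a \<noteq> y"
  shows "(a, x, y) \<in> Z \<longleftrightarrow> arc_content Z a x < arc_content Z a y"
proof (cases "x = y")
  case True
  then show ?thesis using tco_mem by blast
next
  case False
  then show ?thesis
    using tco_linear[OF assms False] arc_content_strict_mono[of a x y] arc_content_strict_mono[of a y x]
    by force
qed

lemma arc_content_inj:
  assumes "a \<in> X"
  shows "inj_on (arc_content Z a) (X - {a})"
proof (rule inj_onI, rule ccontr)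
  fix x y assume *: "x \<in> X - {a}" "y \<in> X - {a}" "arc_content Z a x = arc_content Z a y" "x \<noteq> y"
  then have "(a, x, y) \<in> Z \<or> (a, y, x) \<in> Z"
    using tco_linear[of a x y] assms by blast
  then show False using arc_content_strict_mono * by fastforce
qed

text \<open>The arc from \<open>a\<close> to \<open>c\<close> is the disjoint union of the arc from
  \<open>a\<close> to \<open>b\<close>, the point \<open>b\<close>, and the arc from
  \<open>b\<close> to \<open>c\<close>.\<close>

lemma arc_content_add:
  assumes "(a, b, c) \<in> Z"
  shows "arc_content Z a c = arc_content Z a b + arc_content Z b c + 1"
proof -
  note abc = tco_mem[OF assms]
  have "x = b \<or> (a, x, b) \<in> Z \<or> (b, x, c) \<in> Z" if x: "(a, x, c) \<in> Z" for x
  proof (rule ccontr)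
    assume *: "\<not> ?thesis"
    note mem = tco_mem[OF x]
    from * have "(a, b, x) \<in> Z" "(b, c, x) \<in> Z"
      using tco_linear[of a x b] tco_linear[of b x c] abc mem by blast+
    \<comment> \<open>Seen from \<open>x\<close>, the order is \<open>a\<close>, \<open>b\<close>,
      \<open>c\<close>, which reverses the triple \<open>(a, x, c)\<close>.\<close>
    then have "(x, b, c) \<in> Z" "(x, a, b) \<in> Z" using tco_rotate by blast+
    then have "(x, a, c) \<in> Z" using tco_trans by blast
    then show False using x tco_asym tco_rotate by blast
  qed
  moreover have "(a, x, c) \<in> Z" if "(b, x, c) \<in> Z" for x
    using that assms tco_trans[of c a b x] tco_rotate by blast
  ultimately have eq: "{x. (a, x, c) \<in> Z} = insert b ({x. (a, x, b) \<in> Z} \<union> {x. (b, x, c) \<in> Z})"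
    using assms tco_trans by blast
  have "{x. (a, x, b) \<in> Z} \<inter> {x. (b, x, c) \<in> Z} = {}"
  proof -
    have False if "(a, x, b) \<in> Z" "(b, x, c) \<in> Z" for x
    proof -
      \<comment> \<open>Seen from \<open>b\<close>, \<open>c\<close> precedes \<open>a\<close> and
        \<open>a\<close> precedes \<open>x\<close>, although \<open>x\<close> should precede
        \<open>c\<close>.\<close>
      have "(b, a, x) \<in> Z" "(b, c, a) \<in> Z" using that assms tco_rotate by blast+
      then show False using that tco_trans tco_asym tco_rotate by blast
    qed
    then show ?thesis by blast
  qed
  moreover have "b \<notin> {x. (a, x, b) \<in> Z} \<union> {x. (b, x, c) \<in> Z}" using tco_mem by blast
  ultimately show ?thesis
    unfolding arc_content_def eq using tco_finite_arc by (simp add: card_Un_disjoint)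
qed

lemma arc_content_complement:
  assumes "a \<in> X" "b \<in> X" "a \<noteq> b"
  shows "arc_content Z a b + arc_content Z b a + 2 = card X"
proof -
  have eq: "X = {a, b} \<union> ({x. (a, x, b) \<in> Z} \<union> {x. (b, x, a) \<in> Z})"
    using assms tco_total[of a _ b] tco_mem by blast
  have "{x. (a, x, b) \<in> Z} \<inter> {x. (b, x, a) \<in> Z} = {}" using tco_asym by blast
  moreover have "{a, b} \<inter> ({x. (a, x, b) \<in> Z} \<union> {x. (b, x, a) \<in> Z}) = {}" using tco_mem by blast
  ultimately have "card ({a, b} \<union> ({x. (a, x, b) \<in> Z} \<union> {x. (b, x, a) \<in> Z}))
      = 2 + (arc_content Z a b + arc_content Z b a)"
    unfolding arc_content_def using tco_finite_arc assms by (simp add: card_Un_disjoint)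
  then show ?thesis using eq by simp
qed

text \<open>Distinct elements have distinct contents below \<open>card X - 1\<close>, and there are
  exactly that many elements, so every value is attained.\<close>

lemma arc_content_bij:
  assumes "a \<in> X"
  shows "bij_betw (arc_content Z a) (X - {a}) {..<card X - 1}"
proof -
  have "arc_content Z a ` (X - {a}) \<subseteq> {..<card X - 1}"
    using arc_content_complement[OF assms] by fastforce
  moreover have "card (arc_content Z a ` (X - {a})) = card X - 1"
    using card_image[OF arc_content_inj[OF assms]] assms tco_finite by simp
  ultimately show ?thesis
    using arc_content_inj[OF assms] card_subset_eq[of "{..<card X - 1}"] 
    unfolding bij_betw_def by simp
qed

end

section \<open>Cyclic orders as labellings\<close>

definition cyclic_less :: "nat \<Rightarrow> nat \<Rightarrow> nat \<Rightarrow> bool" where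
  "cyclic_less x y z \<longleftrightarrow> x < y \<and> y < z \<or> y < z \<and> z < x \<or> z < x \<and> x < y"

definition cyclic_order_of :: "'a set \<Rightarrow> ('a \<Rightarrow> nat) \<Rightarrow> ('a \<times> 'a \<times> 'a) set" where
  "cyclic_order_of X p = {(x, y, z). x \<in> X \<and> y \<in> X \<and> z \<in> X \<and> cyclic_less (p x) (p y) (p z)}"

text \<open>The circle is cut open at \<open>a\<close>. The \<open>Suc\<close> keeps label 0 for
  \<open>a\<close> alone, since the successor of \<open>a\<close> already has content 0.\<close>

definition position :: "('a \<times> 'a \<times> 'a) set \<Rightarrow> 'a \<Rightarrow> 'a \<Rightarrow> nat" where
  "position Z a x = (if x = a then 0 else Suc (arc_content Z a x))"

lemma total_cyclic_order_on_cyclic_order_of: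
  assumes "finite X" "inj_on p X"
  shows "total_cyclic_order_on X (cyclic_order_of X p)"
proof -
  have "p x = p y \<longleftrightarrow> x = y" if "x \<in> X" "y \<in> X" for x y
    using assms(2) that by (meson inj_onD)
  then have "p x < p y \<or> p y < p x" if "x \<in> X" "y \<in> X" "x \<noteq> y" for x y
    using that by (metis nat_neq_iff)
  then show ?thesis
    unfolding total_cyclic_order_on_def cyclic_order_of_def cyclic_less_def
    using assms(1)
    by (intro conjI; fastforce)
qed

text \<open>Each triple of distinct elements has exactly one orientation in either order, so one
  order cannot be properly contained in the other.\<close>

lemma tco_eqI:
  assumes "total_cyclic_order_on X Z" "total_cyclic_order_on X C" "C \<subseteq> Z"
  shows "C = Z"
proof -
  have "(x, y, z) \<in> C" if "(x, y, z) \<in> Z" for x y z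
    using that tco_mem[OF assms(1) that] tco_total[OF assms(2), of x y z] tco_asym[OF assms(1) that]
      assms(3) by blast
  then show ?thesis using assms(3) by auto
qed

lemma position_inj:
  assumes "total_cyclic_order_on X Z" "a \<in> X"
  shows "inj_on (position Z a) X"
  using arc_content_inj[OF assms] by (auto simp: inj_on_def position_def)

lemma cyclic_order_of_position:
  assumes Z: "total_cyclic_order_on X Z" and a: "a \<in> X"
  shows "cyclic_order_of X (position Z a) = Z"
proof (rule tco_eqI[OF Z])
  show "total_cyclic_order_on X (cyclic_order_of X (position Z a))"
    by (rule total_cyclic_order_on_cyclic_order_of[OF tco_finite[OF Z] position_inj[OF Z a]])
  \<comment> \<open>Every triple of the labelled order is a rotation of one with increasing labels,
    so these suffice.\<close>
  have inc: "(x, y, z) \<in> Z"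
    if "x \<in> X" "y \<in> X" "z \<in> X" "position Z a x < position Z a y" "position Z a y < position Z a z"
    for x y z
  proof -
    have "y \<noteq> a" "z \<noteq> a" using that by (auto simp: position_def)
    then have yz: "(a, y, z) \<in> Z"
      using that a arc_content_less_iff[OF Z, of a y z] by (simp add: position_def)
    show ?thesis
    proof (cases "x = a")
      case True
      then show ?thesis using yz by simp
    next
      case False
      then have "(a, x, y) \<in> Z"
        using \<open>y \<noteq> a\<close> that a arc_content_less_iff[OF Z, of a x y] by (simp add: position_def)
      then show ?thesis using yz tco_trans[OF Z, of y z a x] tco_rotate[OF Z] by blast
    qed
  qed
  show "cyclic_order_of X (position Z a) \<subseteq> Z"
    unfolding cyclic_order_of_def cyclic_less_def using inc tco_rotate_iff[OF Z] by blast
qed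

section \<open>Inserting an element\<close>

abbreviation restrict_order :: "'a set \<Rightarrow> ('a \<times> 'a \<times> 'a) set \<Rightarrow> ('a \<times> 'a \<times> 'a) set" where
  "restrict_order X Z \<equiv> Z \<inter> X \<times> X \<times> X"

lemma total_cyclic_order_on_restrict:
  assumes "total_cyclic_order_on Y Z" "X \<subseteq> Y"
  shows "total_cyclic_order_on X (restrict_order X Z)"
proof -
  have "finite X" using tco_finite[OF assms(1)] assms(2) finite_subset by blast
  then show ?thesis
    unfolding total_cyclic_order_on_def
    using tco_mem[OF assms(1)] tco_rotate[OF assms(1)] tco_asym[OF assms(1)] tco_trans[OF assms(1)]
      tco_total[OF assms(1)] assms(2)
    by (intro conjI) (blast+)
qed

text \<open>Deleting \<open>q\<close> shortens exactly those arcs on which it lies. Membership is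
  phrased as a comparison of contents so that later steps become arithmetic.\<close>

lemma arc_content_restrict:
  assumes Z: "total_cyclic_order_on (insert q X) Z" and q: "q \<notin> X"
    and ab: "a \<in> X" "b \<in> X" "a \<noteq> b"
  shows "arc_content Z a b
    = arc_content (restrict_order X Z) a b + of_bool (arc_content Z a q < arc_content Z a b)"
proof -
  have less: "arc_content Z a q < arc_content Z a b \<longleftrightarrow> (a, q, b) \<in> Z"
    using arc_content_less_iff[OF Z, of a q b] ab q by auto
  define B where "B = {x. (a, x, b) \<in> restrict_order X Z}"
  have "{x. (a, x, b) \<in> Z} = (if (a, q, b) \<in> Z then insert q B else B)"
    using tco_mem[OF Z, of a _ b] ab unfolding B_def by auto
  moreover have "finite B" "q \<notin> B"
    unfolding B_def using q by (auto intro: finite_subset[OF _ tco_finite_arc[OF Z, of a b]])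
  ultimately have "card {x. (a, x, b) \<in> Z} = card B + of_bool ((a, q, b) \<in> Z)"
    by simp
  then show ?thesis
    unfolding less unfolding arc_content_def B_def .
qed

text \<open>Decides from the smaller order alone on which side of \<open>b\<close> the new element
  falls. If \<open>q\<close> comes before \<open>b\<close>, the content of \<open>b\<close> in
  \<open>Z\<close> is one more than in the restriction, hence the non-strict inequality; otherwise
  it is unchanged, and injectivity makes it strictly smaller than that of \<open>q\<close>.\<close>

lemma insert_between_iff:
  assumes Z: "total_cyclic_order_on (insert q X) Z" and q: "q \<notin> X"
    and ab: "a \<in> X" "b \<in> X" "a \<noteq> b"
  shows "(a, q, b) \<in> Z \<longleftrightarrow> arc_content Z a q \<le> arc_content (restrict_order X Z) a b"
proof -
  have "arc_content Z a b \<noteq> arc_content Z a q"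
  proof
    assume "arc_content Z a b = arc_content Z a q"
    then have "b = q"
      by (rule inj_onD[OF arc_content_inj[OF Z], rotated]) (use ab q in auto)
    then show False using ab q by blast
  qed
  then show ?thesis
    using arc_content_restrict[OF assms] arc_content_less_iff[OF Z, of a q b] ab q
    by (auto simp: of_bool_def split: if_splits)
qed

text \<open>The restriction and the content of \<open>q\<close> determine the position of every
  element relative to \<open>a\<close>, and positions determine the order.\<close>

lemma insert_unique:
  assumes Z: "total_cyclic_order_on (insert q X) Z" and Y: "total_cyclic_order_on (insert q X) Y"
    and q: "q \<notin> X" and a: "a \<in> X"
    and restrict: "restrict_order X Z = restrict_order X Y"
    and content: "arc_content Z a q = arc_content Y a q"
  shows "Z = Y"
proof -
  have "position Z a b = position Y a b" if b: "b \<in> insert q X" for b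
  proof (cases "b = q \<or> b = a")
    case True
    then show ?thesis using content by (auto simp: position_def)
  next
    case False
    then have b': "b \<in> X" "b \<noteq> a" using b by auto
    have "(a, q, b) \<in> Z \<longleftrightarrow> (a, q, b) \<in> Y"
      using insert_between_iff[OF Z q a b'(1)] insert_between_iff[OF Y q a b'(1)] b'(2)
      unfolding restrict content by simp
    then have "arc_content Z a b = arc_content Y a b"
      using arc_content_restrict[OF Z q a b'(1)] arc_content_restrict[OF Y q a b'(1)] b'(2)
        arc_content_less_iff[OF Z, of a q b] arc_content_less_iff[OF Y, of a q b] a b' q
      unfolding restrict by (cases "a = q") auto
    then show ?thesis by (simp add: position_def)
  qed
  then have "cyclic_order_of (insert q X) (position Z a) = cyclic_order_of (insert q X) (position Y a)"
    unfolding cyclic_order_of_def by auto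
  then show ?thesis
    using cyclic_order_of_position[OF Z] cyclic_order_of_position[OF Y] a by simp
qed

lemma insert_exists:
  assumes Z: "total_cyclic_order_on X Z" and q: "q \<notin> X" and a: "a \<in> X" and r: "r < card X"
  shows "\<exists>Y. total_cyclic_order_on (insert q X) Y \<and> restrict_order X Y = Z \<and> arc_content Y a q = r"
proof (intro exI conjI)
  \<comment> \<open>Labels above \<open>r\<close> move up by one to free \<open>Suc r\<close> for
    \<open>q\<close>. The labels up to \<open>r\<close> belong to \<open>a\<close> and the
    \<open>r\<close> elements that are to precede \<open>q\<close>.\<close>
  define p where "p x = (if x = q then Suc r else if position Z a x \<le> r then position Z a x
    else Suc (position Z a x))" for x
  let ?Y = "cyclic_order_of (insert q X) p"
  have aq: "a \<noteq> q" using a q by blast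
  have "inj_on p (insert q X)"
    using position_inj[OF Z a] q by (auto simp: inj_on_def p_def)
  then show "total_cyclic_order_on (insert q X) ?Y"
    using tco_finite[OF Z] total_cyclic_order_on_cyclic_order_of by blast
  have p_mono: "p x < p y \<longleftrightarrow> position Z a x < position Z a y" if "x \<in> X" "y \<in> X" for x y
    using that q by (auto simp: p_def)
  have "restrict_order X ?Y = cyclic_order_of X (position Z a)"
    using p_mono by (auto simp: cyclic_order_of_def cyclic_less_def)
  then show "restrict_order X ?Y = Z" using cyclic_order_of_position[OF Z a] by simp
  have arc: "{x. (a, x, q) \<in> ?Y} = {x \<in> X - {a}. arc_content Z a x < r}"
    using aq q a by (auto simp: cyclic_order_of_def cyclic_less_def p_def position_def split: if_splits)
  have "bij_betw (arc_content Z a) {x \<in> X - {a}. arc_content Z a x < r} {..<r}"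
  proof -
    have "arc_content Z a ` {x \<in> X - {a}. arc_content Z a x < r} = {..<r}"
    proof (intro equalityI subsetI)
      fix t assume "t \<in> {..<r}"
      then have "t \<in> arc_content Z a ` (X - {a})"
        using arc_content_bij[OF Z a] r by (auto simp: bij_betw_def)
      then show "t \<in> arc_content Z a ` {x \<in> X - {a}. arc_content Z a x < r}"
        using \<open>t \<in> {..<r}\<close> by auto
    qed auto
    then show ?thesis
      using arc_content_inj[OF Z a] unfolding bij_betw_def by (auto simp: inj_on_def)
  qed
  then show "arc_content ?Y a q = r"
    unfolding arc_content_def[of ?Y] arc using bij_betw_same_card by fastforce
qed

text \<open>For a fixed \<open>r\<close>, restriction is a bijection: the content of the new element
  can be prescribed independently of the smaller order.\<close>

lemma card_insert_orders:
  assumes q: "q \<notin> X" and a: "a \<in> X" and r: "r < card X"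
    and A: "\<And>Z. Z \<in> A \<Longrightarrow> total_cyclic_order_on X Z"
  shows "card {Y. total_cyclic_order_on (insert q X) Y \<and> restrict_order X Y \<in> A \<and> arc_content Y a q = r}
    = card A"
proof (rule bij_betw_same_card[of "restrict_order X"], unfold bij_betw_def, intro conjI)
  show "inj_on (restrict_order X)
    {Y. total_cyclic_order_on (insert q X) Y \<and> restrict_order X Y \<in> A \<and> arc_content Y a q = r}"
    using insert_unique[OF _ _ q a] by (auto intro!: inj_onI)
  show "restrict_order X `
    {Y. total_cyclic_order_on (insert q X) Y \<and> restrict_order X Y \<in> A \<and> arc_content Y a q = r} = A"
    using insert_exists[OF A q a r] by (auto simp: image_iff)
qed

section \<open>Counting by two contents\<close>

lemma P_set_tco: "Z \<in> P_set w \<Longrightarrow> total_cyclic_order_on {1..length w + 2} Z"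
  unfolding P_set_def by simp

definition content_count :: "sign list \<Rightarrow> nat \<Rightarrow> nat \<Rightarrow> nat" where
  "content_count w s t = (let m = length w + 2 in
     card {Z \<in> P_set w. arc_content Z m 1 = s \<and> arc_content Z m (m - 1) = t})"

lemma finite_P_set: "finite (P_set w)"
proof (rule finite_subset)
  let ?X = "{1..length w + 2}"
  show "P_set w \<subseteq> Pow (?X \<times> ?X \<times> ?X)"
    using tco_mem[OF P_set_tco] by auto
qed simp

text \<open>Only the condition of the appended letter involves the new element \<open>Suc m\<close>;
  all others concern triples within \<open>{1..m}\<close> and survive restriction.\<close>

lemma P_set_append:
  fixes w :: "sign list"
  defines "m \<equiv> length w + 2"
  shows "Z \<in> P_set (w @ [e]) \<longleftrightarrow>
    total_cyclic_order_on (insert (Suc m) {1..m}) Z \<and> restrict_order {1..m} Z \<in> P_set w \<and>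
    (if e = Plus then (m - 1, m, Suc m) \<in> Z else (Suc m, m, m - 1) \<in> Z)"
proof -
  have X: "insert (Suc m) {1..m} = {1..length (w @ [e]) + 2}" unfolding m_def by auto
  have letters: "(\<forall>i\<in>{1..length (w @ [e])}. Q i ((w @ [e]) ! (i - 1))) \<longleftrightarrow>
      (\<forall>i\<in>{1..length w}. Q i (w ! (i - 1))) \<and> Q (m - 1) e" for Q
  proof -
    \<comment> \<open>Counting letters from 1, the appended one has number
      \<open>length w + 1\<close>, which is \<open>m - 1\<close>.\<close>
    have "{1..length (w @ [e])} = insert (m - 1) {1..length w}" unfolding m_def by auto
    then show ?thesis by (simp add: nth_append m_def) auto
  qed
  have eqs: "m - 1 + 1 = m" "m - 1 + 2 = Suc m" unfolding m_def by auto
  have restrict: "(i, i + 1, i + 2) \<in> restrict_order {1..m} Z \<longleftrightarrow> (i, i + 1, i + 2) \<in> Z"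
    "(i + 2, i + 1, i) \<in> restrict_order {1..m} Z \<longleftrightarrow> (i + 2, i + 1, i) \<in> Z"
    if "i \<in> {1..length w}" for i
    using that unfolding m_def by auto
  have last: "(e = Plus \<longrightarrow> (m - 1, m - 1 + 1, m - 1 + 2) \<in> Z) \<and> (e = Minus \<longrightarrow> (m - 1 + 2, m - 1 + 1, m - 1) \<in> Z)
      \<longleftrightarrow> (if e = Plus then (m - 1, m, Suc m) \<in> Z else (Suc m, m, m - 1) \<in> Z)"
    unfolding eqs by (cases e) auto
  have tco: "total_cyclic_order_on (insert (Suc m) {1..m}) Z \<Longrightarrow>
      total_cyclic_order_on {1..m} (restrict_order {1..m} Z)"
    by (erule total_cyclic_order_on_restrict) blast
  have "restrict_order {1..m} Z \<in> P_set w \<longleftrightarrow>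
    total_cyclic_order_on {1..m} (restrict_order {1..m} Z) \<and>
    (\<forall>i\<in>{1..length w}. (w ! (i - 1) = Plus \<longrightarrow> (i, i + 1, i + 2) \<in> Z) \<and>
      (w ! (i - 1) = Minus \<longrightarrow> (i + 2, i + 1, i) \<in> Z))"
    unfolding P_set_def m_def[symmetric] mem_Collect_eq using restrict
    by (intro arg_cong2[of _ _ _ _ "(\<and>)"] ball_cong refl) simp_all
  moreover have "Z \<in> P_set (w @ [e]) \<longleftrightarrow> total_cyclic_order_on (insert (Suc m) {1..m}) Z \<and>
    (\<forall>i\<in>{1..length w}. (w ! (i - 1) = Plus \<longrightarrow> (i, i + 1, i + 2) \<in> Z) \<and>
      (w ! (i - 1) = Minus \<longrightarrow> (i + 2, i + 1, i) \<in> Z)) \<and>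
    (if e = Plus then (m - 1, m, Suc m) \<in> Z else (Suc m, m, m - 1) \<in> Z)"
    unfolding P_set_def X mem_Collect_eq last[symmetric]
    using letters[of "\<lambda>i e. (e = Plus \<longrightarrow> (i, i + 1, i + 2) \<in> Z) \<and> (e = Minus \<longrightarrow> (i + 2, i + 1, i) \<in> Z)"]
    by blast
  ultimately show ?thesis using tco by blast
qed

text \<open>Seen from \<open>m\<close>, the letter \<open>Plus\<close> puts \<open>Suc m\<close>
  before \<open>m - 1\<close>, and \<open>Minus\<close> puts it after. With \<open>t\<close> the
  content from \<open>m\<close> to \<open>m - 1\<close> in the restricted order, these conditions
  are \<open>r \<le> t\<close> and \<open>t < r\<close>.\<close>

lemma card_P_set_append:
  fixes w :: "sign list"
  defines "m \<equiv> length w + 2"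
  assumes w: "length w \<ge> 1" and r: "r < m"
  shows "card {Z \<in> P_set (w @ [e]). arc_content Z m (Suc m) = r \<and>
      arc_content (restrict_order {1..m} Z) m 1 = s} =
    (\<Sum>t\<in>(if e = Plus then {r..length w} else {..<r}). content_count w s t)"
proof -
  let ?X = "{1..m}" and ?T = "if e = Plus then {r..length w} else {..<r}"
  define A where "A t = {Z \<in> P_set w. arc_content Z m 1 = s \<and> arc_content Z m (m - 1) = t}" for t
  have q: "Suc m \<notin> ?X" and a: "m \<in> ?X" and b: "m - 1 \<in> ?X" "m \<noteq> m - 1"
    using w unfolding m_def by auto
  have last: "(if e = Plus then (m - 1, m, Suc m) \<in> Z else (Suc m, m, m - 1) \<in> Z) \<longleftrightarrow>
      arc_content (restrict_order ?X Z) m (m - 1) \<in> ?T"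
    if Z: "total_cyclic_order_on (insert (Suc m) ?X) Z" and r: "arc_content Z m (Suc m) = r" for Z
  proof -
    note Z' = total_cyclic_order_on_restrict[OF Z subset_insertI]
    \<comment> \<open>An arc in an order on \<open>m\<close> points has content at most
      \<open>m - 2\<close>; this closes the interval for \<open>Plus\<close>.\<close>
    have "arc_content (restrict_order ?X Z) m (m - 1) \<le> length w"
      using arc_content_complement[OF Z' a b] by (simp add: m_def)
    moreover have "(m, Suc m, m - 1) \<in> Z \<longleftrightarrow> (m - 1, Suc m, m) \<notin> Z"
      using tco_total[OF Z, of m "Suc m" "m - 1"] tco_asym[OF Z] a b q by auto
    ultimately show ?thesis
      using insert_between_iff[OF Z q a b] r
        tco_rotate_iff[OF Z, of "m - 1" m "Suc m"] tco_rotate_iff[OF Z, of "m - 1" "Suc m" m]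
        tco_rotate_iff[OF Z, of "Suc m" m "m - 1"]
      by auto
  qed
  have "{Z \<in> P_set (w @ [e]). arc_content Z m (Suc m) = r \<and> arc_content (restrict_order ?X Z) m 1 = s}
    = {Z. total_cyclic_order_on (insert (Suc m) ?X) Z \<and> restrict_order ?X Z \<in> (\<Union>t\<in>?T. A t) \<and>
        arc_content Z m (Suc m) = r}"
    using last P_set_append[of _ w e, folded m_def] unfolding A_def by blast
  also have "card \<dots> = card (\<Union>t\<in>?T. A t)"
    by (rule card_insert_orders[OF q a]) (use r P_set_tco in \<open>auto simp: A_def m_def\<close>)
  also have "\<dots> = (\<Sum>t\<in>?T. card (A t))"
    by (rule card_UN_disjoint) (auto simp: A_def finite_P_set)
  finally show ?thesis unfolding A_def content_count_def Let_def m_def .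
qed

section \<open>Translation of \<open>f_plus\<close> and \<open>f_minus\<close> into content
  counts\<close>

lemma multi_content_3:
  "multi_content Z [x, y, z] = [arc_content Z x y, arc_content Z y z, arc_content Z z x]"
  by (simp add: multi_content_def)

text \<open>Here \<open>Suc m\<close> lies on the arc from \<open>m\<close> to 1, which has content
  \<open>i + j + 1\<close> and loses one point when \<open>Suc m\<close> is deleted. The value
  \<open>k\<close> is then forced by the complementary arc.\<close>

lemma f_plus_append:
  assumes w: "length w \<ge> 1" and ijk: "i + j + k = length w"
  shows "f_plus (w @ [e]) i j k =
    (\<Sum>t\<in>(if e = Plus then {i..length w} else {..<i}). content_count w (i + j) t)"
proof -
  define m where "m = length w + 2"
  let ?X = "{1..m}"
  have q: "Suc m \<notin> ?X" and a: "m \<in> ?X" and b: "1 \<in> ?X" "m \<noteq> 1"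
    unfolding m_def by auto
  have "(m, Suc m, 1) \<in> Z \<and> arc_content Z m (Suc m) = i \<and> arc_content Z (Suc m) 1 = j \<and> arc_content Z 1 m = k
      \<longleftrightarrow> arc_content Z m (Suc m) = i \<and> arc_content (restrict_order ?X Z) m 1 = i + j"
    if Z: "total_cyclic_order_on (insert (Suc m) ?X) Z" for Z
  proof -
    have "arc_content Z m 1 + arc_content Z 1 m = length w + 1"
      using arc_content_complement[OF Z, of m 1] a b by (simp add: m_def)
    then show ?thesis
      using arc_content_add[OF Z, of m "Suc m" 1] insert_between_iff[OF Z q a b]
        arc_content_less_iff[OF Z, of m "Suc m" 1] arc_content_restrict[OF Z q a b] a b q ijk
      by auto
  qed
  then have "{Z \<in> Q_plus (w @ [e]). multi_content Z [m, Suc m, 1] = [i, j, k]} =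
    {Z \<in> P_set (w @ [e]). arc_content Z m (Suc m) = i \<and> arc_content (restrict_order ?X Z) m 1 = i + j}"
    unfolding Q_plus_def Let_def multi_content_3 using P_set_append[of _ w e, folded m_def]
    by (auto simp: m_def)
  then show ?thesis
    using card_P_set_append[OF w, of i e "i + j"] ijk unfolding f_plus_def Let_def by (simp add: m_def)
qed

text \<open>Now 1 lies on the arc from \<open>m\<close> to \<open>Suc m\<close>, whose content is
  therefore \<open>j + k + 1\<close>, while the arc from \<open>m\<close> to 1 is unaffected by
  deleting \<open>Suc m\<close>.\<close>

lemma f_minus_append:
  assumes w: "length w \<ge> 1" and ijk: "i + j + k = length w"
  shows "f_minus (w @ [e]) i j k =
    (\<Sum>t\<in>(if e = Plus then {j + k + 1..length w} else {..<j + k + 1}). content_count w j t)"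
proof -
  define m where "m = length w + 2"
  let ?X = "{1..m}"
  have q: "Suc m \<notin> ?X" and a: "m \<in> ?X" and b: "1 \<in> ?X" "m \<noteq> 1"
    unfolding m_def by auto
  have "(1, Suc m, m) \<in> Z \<and> arc_content Z (Suc m) m = i \<and> arc_content Z m 1 = j \<and> arc_content Z 1 (Suc m) = k
      \<longleftrightarrow> arc_content Z m (Suc m) = j + k + 1 \<and> arc_content (restrict_order ?X Z) m 1 = j"
    if Z: "total_cyclic_order_on (insert (Suc m) ?X) Z" for Z
  proof -
    have "arc_content Z m (Suc m) + arc_content Z (Suc m) m = length w + 1"
      using arc_content_complement[OF Z, of m "Suc m"] a q by (simp add: m_def)
    moreover have "(1, Suc m, m) \<in> Z \<longleftrightarrow> (m, 1, Suc m) \<in> Z"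
      using tco_rotate_iff[OF Z] by blast
    ultimately show ?thesis
      using arc_content_add[OF Z, of m 1 "Suc m"] insert_between_iff[OF Z q a b]
        arc_content_less_iff[OF Z, of m "Suc m" 1] arc_content_less_iff[OF Z, of m 1 "Suc m"]
        arc_content_restrict[OF Z q a b] a b q ijk
      by auto
  qed
  then have "{Z \<in> Q_minus (w @ [e]). multi_content Z [Suc m, m, 1] = [i, j, k]} =
    {Z \<in> P_set (w @ [e]). arc_content Z m (Suc m) = j + k + 1 \<and> arc_content (restrict_order ?X Z) m 1 = j}"
    unfolding Q_minus_def Let_def multi_content_3 using P_set_append[of _ w e, folded m_def]
    by (auto simp: m_def)
  then show ?thesis
    using card_P_set_append[OF w, of "j + k + 1" e j] ijk unfolding f_minus_def Let_def by (simp add: m_def)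
qed

text \<open>Seen from \<open>m\<close>, 1 precedes \<open>m - 1\<close>, so \<open>f_plus\<close>
  supplies the counts with \<open>s < t\<close>.\<close>

lemma f_plus_eq_content_count:
  assumes ijk: "i + j + k + 1 = length w"
  shows "f_plus w i j k = content_count w j (j + k + 1)"
proof -
  define m where "m = length w + 2"
  have mem: "m \<in> {1..m}" "m - 1 \<in> {1..m}" "1 \<in> {1..m}" "m \<noteq> m - 1" "m \<noteq> 1"
    using ijk unfolding m_def by auto
  have "(m - 1, m, 1) \<in> Z \<and> arc_content Z (m - 1) m = i \<and> arc_content Z m 1 = j \<and> arc_content Z 1 (m - 1) = k
      \<longleftrightarrow> arc_content Z m 1 = j \<and> arc_content Z m (m - 1) = j + k + 1"
    if Z: "total_cyclic_order_on {1..m} Z" for Z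
  proof -
    have "arc_content Z m (m - 1) + arc_content Z (m - 1) m = length w"
      using arc_content_complement[OF Z mem(1,2,4)] by (simp add: m_def)
    then show ?thesis
      using arc_content_add[OF Z, of m 1 "m - 1"] tco_rotate_iff[OF Z, of "m - 1" m 1]
        arc_content_less_iff[OF Z mem(1,3,2,5,4)] ijk
      by auto
  qed
  then show ?thesis
    unfolding f_plus_def content_count_def Q_plus_def Let_def multi_content_3 m_def[symmetric]
    using P_set_tco[of _ w, folded m_def] by (intro arg_cong[of _ _ card]) auto
qed

text \<open>The mirror case: \<open>m - 1\<close> precedes 1, so \<open>f_minus\<close> supplies the
  counts with \<open>t < s\<close>.\<close>

lemma f_minus_eq_content_count:
  assumes ijk: "i + j + k + 1 = length w"
  shows "f_minus w i j k = content_count w (i + j + 1) i"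
proof -
  define m where "m = length w + 2"
  have mem: "m \<in> {1..m}" "m - 1 \<in> {1..m}" "1 \<in> {1..m}" "m \<noteq> m - 1" "m \<noteq> 1"
    using ijk unfolding m_def by auto
  have "(1, m, m - 1) \<in> Z \<and> arc_content Z m (m - 1) = i \<and> arc_content Z (m - 1) 1 = j \<and> arc_content Z 1 m = k
      \<longleftrightarrow> arc_content Z m 1 = i + j + 1 \<and> arc_content Z m (m - 1) = i"
    if Z: "total_cyclic_order_on {1..m} Z" for Z
  proof -
    have "arc_content Z m 1 + arc_content Z 1 m = length w"
      using arc_content_complement[OF Z mem(1,3,5)] by (simp add: m_def)
    then show ?thesis
      using arc_content_add[OF Z, of m "m - 1" 1] tco_rotate_iff[OF Z, of 1 m "m - 1"]
        arc_content_less_iff[OF Z mem(1,2,3,4,5)] ijk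
      by auto
  qed
  then show ?thesis
    unfolding f_minus_def content_count_def Q_minus_def Let_def multi_content_3 m_def[symmetric]
    using P_set_tco[of _ w, folded m_def] by (intro arg_cong[of _ _ card]) auto
qed

text \<open>A nonempty word gives \<open>m \<ge> 3\<close>, so 1 and \<open>m - 1\<close> are
  distinct and cannot have equal content from \<open>m\<close>.\<close>

lemma content_count_diagonal:
  assumes "length w \<ge> 1"
  shows "content_count w s s = 0"
proof -
  define m where "m = length w + 2"
  have mem: "m \<in> {1..m}" "1 \<in> {1..m} - {m}" "m - 1 \<in> {1..m} - {m}" "m - 1 \<noteq> 1"
    using assms unfolding m_def by auto
  have "arc_content Z m 1 \<noteq> arc_content Z m (m - 1)" if "Z \<in> P_set w" for Z
    using inj_onD[OF arc_content_inj[OF P_set_tco[OF that, folded m_def] mem(1)] _ mem(2,3)] mem(4)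
    by auto
  then have "{Z \<in> P_set w. arc_content Z m 1 = s \<and> arc_content Z m (m - 1) = s} = {}"
    by force
  then show ?thesis unfolding content_count_def Let_def m_def[symmetric] by (simp only: card.empty)
qed

section \<open>Reindexing of sums and the four recurrences\<close>

lemma sum_lessThan_shift:
  fixes h :: "nat \<Rightarrow> nat"
  shows "(\<Sum>t<k. h (c + t)) = (\<Sum>t\<in>{c..<c + k}. h t)"
  by (rule sum.reindex_bij_witness[where i = "\<lambda>t. t - c" and j = "\<lambda>t. c + t"]) auto

lemma sum_lessThan_rev:
  fixes h :: "nat \<Rightarrow> nat"
  shows "(\<Sum>t<k. h (c + k - 1 - t)) = (\<Sum>t\<in>{c..<c + k}. h t)"
  by (rule sum.reindex_bij_witness[where i = "\<lambda>t. c + k - 1 - t" and j = "\<lambda>t. c + k - 1 - t"]) auto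

text \<open>Separates the range \<open>t < s\<close>, counted by \<open>f_minus\<close>, from the
  range \<open>t > s\<close>, counted by \<open>f_plus\<close>.\<close>

lemma sum_split_diagonal:
  fixes h :: "nat \<Rightarrow> nat"
  assumes "h s = 0" "a \<le> s" "s < b"
  shows "(\<Sum>t\<in>{a..<b}. h t) = (\<Sum>t\<in>{a..<s}. h t) + (\<Sum>t\<in>{s + 1..<b}. h t)"
  using assms sum.atLeastLessThan_concat[of a s b h] sum.atLeast_Suc_lessThan[of s b h] by simp

theorem theorem2:
  fixes n i j k :: nat and w :: "sign list"
  assumes "n \<ge> 1" and "length w = n" and "i + j + k = n"
  shows "f_plus (w @ [Plus]) i j k =
           (\<Sum>j'<j. f_minus w (i + j - 1 - j') j' k) + (\<Sum>k'<k. f_plus w (k - 1 - k') (i + j) k')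
       \<and> f_minus (w @ [Plus]) i j k = (\<Sum>i'<i. f_plus w i' j (i + k - 1 - i'))
       \<and> f_plus (w @ [Minus]) i j k = (\<Sum>i'<i. f_minus w i' (i + j - 1 - i') k)
       \<and> f_minus (w @ [Minus]) i j k =
           (\<Sum>k'<k. f_plus w (i + k - 1 - k') j k') + (\<Sum>j'<j. f_minus w (j - 1 - j') j' (i + k))"
proof (intro conjI)
  have w: "length w \<ge> 1" and ijk: "i + j + k = length w" using assms by auto
  note diagonal = content_count_diagonal[OF w]
  note plus = f_plus_eq_content_count and minus = f_minus_eq_content_count
  let ?g = "content_count w"

  \<comment> \<open>The interval \<open>{i..length w}\<close> contains the diagonal value
    \<open>i + j\<close>, so both kinds of terms occur. As \<open>j' < j\<close>, the natural
    subtraction does not truncate.\<close>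
  have "(\<Sum>j'<j. f_minus w (i + j - 1 - j') j' k) = (\<Sum>j'<j. ?g (i + j) (i + j - 1 - j'))"
    using ijk by (intro sum.cong refl) (simp add: minus)
  moreover have "(\<Sum>k'<k. f_plus w (k - 1 - k') (i + j) k') = (\<Sum>k'<k. ?g (i + j) (i + j + 1 + k'))"
    using ijk by (intro sum.cong refl) (simp add: plus)
  moreover have "{i..length w} = {i..<i + j + 1 + k}" using ijk by auto
  ultimately show "f_plus (w @ [Plus]) i j k =
      (\<Sum>j'<j. f_minus w (i + j - 1 - j') j' k) + (\<Sum>k'<k. f_plus w (k - 1 - k') (i + j) k')"
    using f_plus_append[OF w ijk, of Plus] sum_lessThan_rev[of "?g (i + j)" i j]
      sum_lessThan_shift[of "?g (i + j)" "i + j + 1" k]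
      sum_split_diagonal[of "?g (i + j)" "i + j" i "i + j + 1 + k"] diagonal
    by simp

  \<comment> \<open>All \<open>t \<ge> j + k + 1\<close> exceed the diagonal value \<open>j\<close>,
    so only \<open>f_plus\<close> occurs.\<close>
  have "(\<Sum>i'<i. f_plus w i' j (i + k - 1 - i')) = (\<Sum>i'<i. ?g j (j + k + 1 + i - 1 - i'))"
    using ijk by (intro sum.cong refl) (auto simp: plus intro!: arg_cong[of _ _ "?g j"])
  moreover have "{j + k + 1..length w} = {j + k + 1..<j + k + 1 + i}" using ijk by auto
  ultimately show "f_minus (w @ [Plus]) i j k = (\<Sum>i'<i. f_plus w i' j (i + k - 1 - i'))"
    using f_minus_append[OF w ijk, of Plus] sum_lessThan_rev[of "?g j" "j + k + 1" i] by simp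

  \<comment> \<open>All \<open>t < i\<close> lie below the diagonal value \<open>i + j\<close>, so
    only \<open>f_minus\<close> occurs.\<close>
  have "(\<Sum>i'<i. f_minus w i' (i + j - 1 - i') k) = (\<Sum>i'<i. ?g (i + j) i')"
    using ijk by (intro sum.cong refl) (simp add: minus)
  then show "f_plus (w @ [Minus]) i j k = (\<Sum>i'<i. f_minus w i' (i + j - 1 - i') k)"
    using f_plus_append[OF w ijk, of Minus] by simp

  \<comment> \<open>The diagonal value \<open>j\<close> splits \<open>{..<j + k + 1}\<close> into
    \<open>k\<close> values above it and \<open>j\<close> values below it.\<close>
  have "(\<Sum>k'<k. f_plus w (i + k - 1 - k') j k') = (\<Sum>k'<k. ?g j (j + 1 + k'))"
    using ijk by (intro sum.cong refl) (simp add: plus)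
  moreover have "(\<Sum>j'<j. f_minus w (j - 1 - j') j' (i + k)) = (\<Sum>j'<j. ?g j (0 + j - 1 - j'))"
    using ijk by (intro sum.cong refl) (simp add: minus)
  moreover have "{..<j + k + 1} = {0..<j + 1 + k}" by auto
  ultimately show "f_minus (w @ [Minus]) i j k =
      (\<Sum>k'<k. f_plus w (i + k - 1 - k') j k') + (\<Sum>j'<j. f_minus w (j - 1 - j') j' (i + k))"
    using f_minus_append[OF w ijk, of Minus] sum_lessThan_rev[of "?g j" 0 j]
      sum_lessThan_shift[of "?g j" "j + 1" k] sum_split_diagonal[of "?g j" j 0 "j + 1 + k"] diagonal
    by simp
qed

end
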